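(* Let $t \geq 1$ and let $H$ be a connected graph with $V(H) = T \cup \{v\}$, where $v \notin T$ and the induced subgraph $H[T]$ is a tree on $t$ vertices. Then for all $n \geq 1$, $\rho(n,H) = \lceil n/t \rceil$.
   Context: An orthonormal representation of a graph $G$ in $\mathbb{R}^d$ is a map $f: V(G) \to \mathbb{R}^d$ with $\|f(u)\|=1$ for all $u$ and $\langle f(u), f(v)\rangle = 0$ for all distinct non-adjacent $u,v$ (distinct vertices may receive the same vector). The minimum semidefinite rank $\mathrm{msr}(G)$ is the minimum $d$ such that $G$ has an orthonormal representation in $\mathbb{R}^d$. A graph is $H$-free if it contains no subgraph isomorphic to $H$. $\rho(n,H)$ is the minimum of $\mathrm{msr}(G)$ over all $H$-free simple graphs $G$ on $n$ vertices. *)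

theory Defs
  imports "Graph_Theory.Graph_Theory" "Jordan_Normal_Form.Matrix"
begin

text \<open>
  A finite simple graph is a \<^locale>\<open>pair_graph\<close>: a finite symmetric loop-free digraph
  whose arcs are pairs of vertices, so that an undirected edge is a pair of opposite arcs.
\<close>

text \<open>
  The library's \<open>forest\<close> (hence \<open>tree\<close>) forbids all directed cycles, including \<open>u, v, u\<close>, so no
  symmetric digraph with an edge satisfies it.  In a symmetric digraph without loops and multiple
  arcs, the cycles of the underlying undirected graph are the directed cycles of length at least 3.
\<close>

definition undirected_tree :: "('a, 'b) pre_digraph \<Rightarrow> bool" where
  "undirected_tree G \<longleftrightarrow> graph G \<and> Digraph_Component.connected G
     \<and> \<not> (\<exists>p. pre_digraph.cycle G p \<and> 3 \<le> length p)"

definition orthonormal_representation ::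
  "'a pair_pre_digraph \<Rightarrow> nat \<Rightarrow> ('a \<Rightarrow> real vec) \<Rightarrow> bool" where
  "orthonormal_representation G d f \<longleftrightarrow>
     (\<forall>u \<in> pverts G. f u \<in> carrier_vec d) \<and>
     (\<forall>u \<in> pverts G. sqrt (f u \<bullet> f u) = 1) \<and>
     (\<forall>u \<in> pverts G. \<forall>v \<in> pverts G. u \<noteq> v \<and> (u, v) \<notin> parcs G \<longrightarrow> f u \<bullet> f v = 0)"

text \<open>
  On a nonempty set of naturals \<^const>\<open>Inf\<close> is the minimum.  The set below is nonempty for every
  finite \<open>G\<close>: assign distinct unit coordinate vectors to the vertices.
\<close>

definition msr :: "'a pair_pre_digraph \<Rightarrow> nat" where
  "msr G = Inf {d. \<exists>f. orthonormal_representation G d f}"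

text \<open>Subgraphs need not be induced.\<close>

definition free_of :: "'h pair_pre_digraph \<Rightarrow> 'a pair_pre_digraph \<Rightarrow> bool" where
  "free_of H G \<longleftrightarrow>
     \<not> (\<exists>K. subgraph K (with_proj G) \<and> digraph_iso (with_proj H) K)"

text \<open>
  Every finite graph is isomorphic to one whose vertices are naturals, so vertex type \<^typ>\<open>nat\<close>
  loses no generality.  If no \<open>H\<close>-free graph on \<open>n\<close> vertices existed, the value would be 0; when
  \<open>H\<close> has an edge, the edgeless graph is \<open>H\<close>-free and the minimum is attained.
\<close>

definition rho :: "nat \<Rightarrow> 'h pair_pre_digraph \<Rightarrow> nat" where
  "rho n H = Inf {msr G | G :: nat pair_pre_digraph.
     pair_graph G \<and> card (pverts G) = n \<and> free_of H G}"

end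

theory Submission
  imports Defs
begin

text \<open>
  Let \<open>G\<close> be \<open>H\<close>-free on \<open>n\<close> vertices with orthonormal representation \<open>f\<close> in dimension \<open>d\<close>.
  No neighbourhood \<open>N(w)\<close> contains the tree \<open>H[T]\<close>.  A nonempty graph of minimum degree at least
  \<open>t - 1\<close> contains every forest on \<open>t\<close> vertices, so every nonempty induced subgraph of \<open>N(w)\<close> has
  a vertex of degree less than \<open>t - 1\<close>, and \<open>N(w)\<close> is \<open>(t - 1)\<close>-colourable.  Colour classes are
  independent, hence orthonormal under \<open>f\<close>, so by Bessel's inequality the squared entries in row \<open>w\<close>
  of the Gram matrix \<open>M\<close> of \<open>f\<close> sum to at most \<open>1 + (t - 1) = t\<close>.  Since \<open>M\<close> has rank at most \<open>d\<close>,
  \<open>n\<^sup>2 = (tr M)\<^sup>2 \<le> d \<cdot> tr (M\<^sup>2) \<le> d \<cdot> t \<cdot> n\<close>.  Disjoint cliques on at most \<open>t\<close> vertices attain the bound.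
\<close>

section \<open>Real vectors\<close>

text \<open>Induction on \<open>F\<close>: subtracting from \<open>w\<close> its projection onto one
  vector \<open>f x\<close> lowers the squared norm by exactly \<open>c\<^sup>2\<close> and leaves
  the inner products with the other vectors unchanged. The induction hypothesis is applied to this
  residual, so \<open>w\<close> has to be arbitrary.\<close>

lemma Bessel_coordinates:
  fixes f :: "'a \<Rightarrow> 'k \<Rightarrow> real" and w :: "'k \<Rightarrow> real"
  assumes "finite F"
    and orth: "\<And>x y. x \<in> F \<Longrightarrow> y \<in> F \<Longrightarrow> (\<Sum>k\<in>K. f x k * f y k) = (if x = y then 1 else 0)"
  shows "(\<Sum>x\<in>F. (\<Sum>k\<in>K. f x k * w k)\<^sup>2) \<le> (\<Sum>k\<in>K. (w k)\<^sup>2)"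
  using \<open>finite F\<close> orth
proof (induction F arbitrary: w rule: finite_induct)
  case empty
  then show ?case by (simp add: sum_nonneg)
next
  case (insert x F)
  define c where "c = (\<Sum>k\<in>K. f x k * w k)"
  define w' where "w' k = w k - c * f x k" for k
  have xx: "(\<Sum>k\<in>K. f x k * f x k) = 1" using insert.prems[of x x] by simp
  have same: "(\<Sum>k\<in>K. f y k * w' k) = (\<Sum>k\<in>K. f y k * w k)" if "y \<in> F" for y
  proof -
    have "(\<Sum>k\<in>K. f y k * f x k) = 0" using insert.prems[of y x] insert.hyps that by auto
    moreover have "(\<Sum>k\<in>K. f y k * w' k) = (\<Sum>k\<in>K. f y k * w k) - c * (\<Sum>k\<in>K. f y k * f x k)"
      by (simp add: w'_def algebra_simps sum_subtractf sum_distrib_left)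
    ultimately show ?thesis by simp
  qed
  have "(\<Sum>k\<in>K. (w' k)\<^sup>2) = (\<Sum>k\<in>K. (w k)\<^sup>2) - 2 * c * c + c\<^sup>2 * (\<Sum>k\<in>K. f x k * f x k)"
    unfolding w'_def power2_diff c_def[symmetric]
    by (subst (3) c_def)
      (simp add: algebra_simps power2_eq_square sum_subtractf sum.distrib sum_distrib_left)
  then have "(\<Sum>k\<in>K. (w' k)\<^sup>2) = (\<Sum>k\<in>K. (w k)\<^sup>2) - c\<^sup>2"
    by (simp add: xx power2_eq_square)
  moreover have "(\<Sum>y\<in>F. (\<Sum>k\<in>K. f y k * w' k)\<^sup>2) \<le> (\<Sum>k\<in>K. (w' k)\<^sup>2)"
    by (rule insert.IH) (use insert.prems in auto)
  ultimately show ?case using insert.hyps by (simp add: same c_def)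
qed

lemma Bessel_vec:
  fixes f :: "'a \<Rightarrow> real vec"
  assumes "finite F" and car: "\<And>x. x \<in> F \<Longrightarrow> f x \<in> carrier_vec d" and w: "w \<in> carrier_vec d"
    and orth: "\<And>x y. x \<in> F \<Longrightarrow> y \<in> F \<Longrightarrow> f x \<bullet> f y = (if x = y then 1 else 0)"
  shows "(\<Sum>x\<in>F. (f x \<bullet> w)\<^sup>2) \<le> w \<bullet> w"
proof -
  have "(\<Sum>k\<in>{0..<d}. f x $ k * f y $ k) = (if x = y then 1 else 0)" if "x \<in> F" "y \<in> F" for x y
    using orth[OF that] car[OF that(2)] by (simp add: scalar_prod_def)
  then have "(\<Sum>x\<in>F. (\<Sum>k\<in>{0..<d}. f x $ k * w $ k)\<^sup>2) \<le> (\<Sum>k\<in>{0..<d}. (w $ k)\<^sup>2)"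
    by (rule Bessel_coordinates[OF \<open>finite F\<close>])
  then show ?thesis using w by (simp add: scalar_prod_def power2_eq_square)
qed

text \<open>Cauchy-Schwarz against the all-ones vector, obtained by summing
  \<open>2ab \<le> a\<^sup>2 + b\<^sup>2\<close> over all pairs of indices.\<close>

lemma sum_squared_le_card_sum_squares:
  fixes a :: "'i \<Rightarrow> real"
  shows "(\<Sum>i\<in>I. a i)\<^sup>2 \<le> card I * (\<Sum>i\<in>I. (a i)\<^sup>2)"
proof -
  have "2 * (\<Sum>i\<in>I. a i)\<^sup>2 = (\<Sum>i\<in>I. \<Sum>j\<in>I. 2 * a i * a j)"
    by (simp add: power2_eq_square sum_product sum_distrib_left mult_ac)
  also have "\<dots> \<le> (\<Sum>i\<in>I. \<Sum>j\<in>I. (a i)\<^sup>2 + (a j)\<^sup>2)"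
    by (intro sum_mono sum_squares_bound)
  also have "\<dots> = 2 * (card I * (\<Sum>i\<in>I. (a i)\<^sup>2))"
    by (simp add: sum.distrib sum_distrib_left)
  finally show ?thesis by simp
qed

text \<open>
  Both sides are read off the \<open>d \<times> d\<close> matrix \<open>S i j = (\<Sum>u\<in>V. f u $ i * f u $ j)\<close>: its trace is
  \<open>card V\<close>, and its Frobenius norm equals that of the Gram matrix.
\<close>

lemma card_squared_le_Gram:
  fixes f :: "'a \<Rightarrow> real vec"
  assumes car: "\<And>x. x \<in> V \<Longrightarrow> f x \<in> carrier_vec d" and unit: "\<And>x. x \<in> V \<Longrightarrow> f x \<bullet> f x = 1"
  shows "(real (card V))\<^sup>2 \<le> d * (\<Sum>u\<in>V. \<Sum>v\<in>V. (f u \<bullet> f v)\<^sup>2)"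
proof -
  define I where "I = {0..<d}"
  define S where "S i j = (\<Sum>u\<in>V. f u $ i * f u $ j)" for i j
  have sp: "f u \<bullet> f v = (\<Sum>i\<in>I. f u $ i * f v $ i)" if "v \<in> V" for u v
    using car[OF that] by (simp add: scalar_prod_def I_def)
  have "real (card V) = (\<Sum>u\<in>V. f u \<bullet> f u)" by (simp add: unit)
  also have "\<dots> = (\<Sum>i\<in>I. S i i)"
    unfolding S_def by (subst sum.swap) (simp add: sp)
  finally have "(real (card V))\<^sup>2 = (\<Sum>i\<in>I. S i i)\<^sup>2" by simp
  also have "\<dots> \<le> d * (\<Sum>i\<in>I. (S i i)\<^sup>2)"
    using sum_squared_le_card_sum_squares[of "\<lambda>i. S i i" I] by (simp add: I_def)
  finally have trace: "(real (card V))\<^sup>2 \<le> d * (\<Sum>i\<in>I. (S i i)\<^sup>2)" .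
  \<comment> \<open>Adding the off-diagonal squares only increases the sum, and the full Frobenius
    norm, unlike the diagonal part, can be written through inner products.\<close>
  have "(\<Sum>i\<in>I. (S i i)\<^sup>2) \<le> (\<Sum>i\<in>I. \<Sum>j\<in>I. (S i j)\<^sup>2)"
    by (intro sum_mono) (rule member_le_sum, auto simp: I_def)
  also have "(\<Sum>i\<in>I. \<Sum>j\<in>I. (S i j)\<^sup>2)
      = (\<Sum>i\<in>I. \<Sum>j\<in>I. \<Sum>u\<in>V. \<Sum>v\<in>V. (f u $ i * f u $ j) * (f v $ i * f v $ j))"
    by (simp add: S_def power2_eq_square sum_product)
  \<comment> \<open>Once the sums over \<open>u\<close> and \<open>v\<close> are outermost, the
    inner double sum factors into two coordinate sums, each equal to
    \<open>f u \<bullet> f v\<close>.\<close>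
  also have "\<dots> = (\<Sum>i\<in>I. \<Sum>u\<in>V. \<Sum>j\<in>I. \<Sum>v\<in>V. (f u $ i * f u $ j) * (f v $ i * f v $ j))"
    by (intro sum.cong refl sum.swap)
  also have "\<dots> = (\<Sum>u\<in>V. \<Sum>i\<in>I. \<Sum>j\<in>I. \<Sum>v\<in>V. (f u $ i * f u $ j) * (f v $ i * f v $ j))"
    by (rule sum.swap)
  also have "\<dots> = (\<Sum>u\<in>V. \<Sum>i\<in>I. \<Sum>v\<in>V. \<Sum>j\<in>I. (f u $ i * f u $ j) * (f v $ i * f v $ j))"
    by (intro sum.cong refl sum.swap)
  also have "\<dots> = (\<Sum>u\<in>V. \<Sum>v\<in>V. \<Sum>i\<in>I. \<Sum>j\<in>I. (f u $ i * f u $ j) * (f v $ i * f v $ j))"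
    by (intro sum.cong refl sum.swap)
  also have "\<dots> = (\<Sum>u\<in>V. \<Sum>v\<in>V. (f u \<bullet> f v)\<^sup>2)"
    by (intro sum.cong refl) (simp add: sp power2_eq_square sum_product mult_ac)
  finally have "(\<Sum>i\<in>I. (S i i)\<^sup>2) \<le> (\<Sum>u\<in>V. \<Sum>v\<in>V. (f u \<bullet> f v)\<^sup>2)" .
  then have "d * (\<Sum>i\<in>I. (S i i)\<^sup>2) \<le> d * (\<Sum>u\<in>V. \<Sum>v\<in>V. (f u \<bullet> f v)\<^sup>2)"
    by (simp add: mult_left_mono)
  with trace show ?thesis by linarith
qed

section \<open>Forests, degeneracy and colourings\<close>

text \<open>Longest-path argument: on a longest path in \<open>S\<close>, built by prepending
  vertices, both given predecessors of the first vertex already lie on the path. At least one of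
  them is not the second vertex, so the segment ending there closes up to a cycle with at least
  three vertices.\<close>

lemma exists_cycle_list:
  assumes "finite S" "S \<noteq> {}" and irr: "\<And>x. (x, x) \<notin> R"
    and two: "\<And>x. x \<in> S \<Longrightarrow> \<exists>y\<in>S. \<exists>z\<in>S. y \<noteq> z \<and> (y, x) \<in> R \<and> (z, x) \<in> R"
  obtains c where "distinct c" "3 \<le> length c" "set c \<subseteq> S" "(last c, hd c) \<in> R"
    "successively (\<lambda>x y. (x, y) \<in> R) c"
proof -
  define P where "P c \<longleftrightarrow> distinct c \<and> c \<noteq> [] \<and> set c \<subseteq> S \<and> successively (\<lambda>x y. (x, y) \<in> R) c" for c
  obtain s where "s \<in> S" using \<open>S \<noteq> {}\<close> by blast
  then have "P [s]" by (simp add: P_def)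
  moreover have "\<forall>c. P c \<longrightarrow> length c < Suc (card S)"
    unfolding P_def using \<open>finite S\<close> by (metis card_mono distinct_card le_imp_less_Suc)
  ultimately obtain c where c: "P c" and max: "\<And>c'. P c' \<Longrightarrow> length c' \<le> length c"
    using ex_has_greatest_nat[of P "[s]" length] by blast
  then obtain x0 r where xr: "c = x0 # r" by (cases c) (auto simp: P_def)
  obtain y z where yz: "y \<in> S" "z \<in> S" "y \<noteq> z" "(y, x0) \<in> R" "(z, x0) \<in> R"
    using two[of x0] c xr by (auto simp: P_def)
  have inr: "a \<in> set r" if "a \<in> S" "(a, x0) \<in> R" for a
  proof (rule ccontr)
    assume "a \<notin> set r"
    moreover have "a \<noteq> x0" using irr that by blast
    ultimately have "P (a # c)" using c xr that by (simp add: P_def)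
    then show False using max by fastforce
  qed
  then obtain b where b: "b \<in> set r" "b \<noteq> hd r" "(b, x0) \<in> R" using yz by metis
  then obtain p q where pq: "r = p @ b # q" by (meson split_list)
  with b have "p \<noteq> []" by auto
  show thesis
  proof (rule that[of "x0 # p @ [b]"])
    show "3 \<le> length (x0 # p @ [b])" using \<open>p \<noteq> []\<close> by (cases p) auto
    have "c = (x0 # p @ [b]) @ q" using xr pq by simp
    then show "distinct (x0 # p @ [b])" "set (x0 # p @ [b]) \<subseteq> S"
      "successively (\<lambda>x y. (x, y) \<in> R) (x0 # p @ [b])"
      using c unfolding P_def
      by (metis distinct_append, metis Un_subset_iff set_append, metis successively_append_iff)
  qed (use b in simp)
qed

text \<open>Leaf removal: embed everything but a vertex \<open>x\<close> with at most one neighbour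
  in \<open>S\<close>, then place \<open>x\<close>. Being a forest is expressed by such a vertex
  existing in every nonempty subset, a property that passes to subsets and so fits the
  induction.\<close>

lemma forest_embeds_if_min_degree:
  assumes "finite S" "card S \<le> t"
    and forest: "\<And>S'. S' \<subseteq> S \<Longrightarrow> S' \<noteq> {} \<Longrightarrow>
      \<exists>x\<in>S'. \<forall>y\<in>S'. \<forall>z\<in>S'. (y, x) \<in> R \<longrightarrow> (z, x) \<in> R \<longrightarrow> y = z"
    and symR: "sym R" and irrR: "\<And>x. (x, x) \<notin> R"
    and symE: "sym E" and irrE: "\<And>x. (x, x) \<notin> E"
    and "finite X" "X \<noteq> {}"
    and deg: "\<And>x. x \<in> X \<Longrightarrow> t \<le> Suc (card {y\<in>X. (x, y) \<in> E})"
  shows "\<exists>g. inj_on g S \<and> g ` S \<subseteq> X \<and> (\<forall>x\<in>S. \<forall>y\<in>S. (x, y) \<in> R \<longrightarrow> (g x, g y) \<in> E)"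
  using \<open>finite S\<close> \<open>card S \<le> t\<close> forest
proof (induction S rule: finite_psubset_induct)
  case (psubset S)
  show ?case
  proof (cases "S = {}")
    case False
    then obtain x where x: "x \<in> S"
      and leaf: "\<And>y z. y \<in> S \<Longrightarrow> z \<in> S \<Longrightarrow> (y, x) \<in> R \<Longrightarrow> (z, x) \<in> R \<Longrightarrow> y = z"
      using psubset.prems(2)[of S] by blast
    define S' where "S' = S - {x}"
    have S: "S = insert x S'" "x \<notin> S'" "finite S'" using x psubset.hyps by (auto simp: S'_def)
    then have card: "Suc (card S') \<le> t" using psubset.prems(1) by simp
    have "S' \<subset> S" using S by auto
    moreover have "\<exists>x\<in>S''. \<forall>y\<in>S''. \<forall>z\<in>S''. (y, x) \<in> R \<longrightarrow> (z, x) \<in> R \<longrightarrow> y = z"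
      if "S'' \<subseteq> S'" "S'' \<noteq> {}" for S''
      using psubset.prems(2) that S(1) by blast
    ultimately have "\<exists>g. inj_on g S' \<and> g ` S' \<subseteq> X \<and> (\<forall>x\<in>S'. \<forall>y\<in>S'. (x, y) \<in> R \<longrightarrow> (g x, g y) \<in> E)"
      using card by (intro psubset.IH) auto
    then obtain g where g: "inj_on g S'" "g ` S' \<subseteq> X"
      "\<And>x y. x \<in> S' \<Longrightarrow> y \<in> S' \<Longrightarrow> (x, y) \<in> R \<Longrightarrow> (g x, g y) \<in> E"
      by blast
    have cg: "card (g ` S') = card S'" using g(1) by (rule card_image)
    have "\<exists>a\<in>X - g ` S'. \<forall>y\<in>S'. (y, x) \<in> R \<longrightarrow> (g y, a) \<in> E"
    proof (cases "\<exists>y\<in>S'. (y, x) \<in> R")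
      case True
      then obtain y where y: "y \<in> S'" "(y, x) \<in> R" by blast
      define N where "N = {a\<in>X. (g y, a) \<in> E}"
      \<comment> \<open>The vertex \<open>g y\<close> is not its own neighbour, so at most
        \<open>card S' - 1\<close> used vertices can occupy its neighbourhood. This saving of one is
        why minimum degree \<open>t - 1\<close> suffices.\<close>
      have "card (g ` S' - {g y}) < card S'"
        using y(1) S(3) cg by (metis card_Diff1_less finite_imageI imageI)
      moreover have "card S' \<le> card N" using deg[of "g y"] y(1) g(2) card unfolding N_def by auto
      ultimately have "\<not> N \<subseteq> g ` S' - {g y}"
        using S(3) card_mono[of "g ` S' - {g y}" N] by auto
      then obtain a where a: "a \<in> N" "a \<notin> g ` S'" using irrE unfolding N_def by blast
      moreover have "z = y" if "z \<in> S'" "(z, x) \<in> R" for z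
        using leaf that y S(1) by blast
      ultimately show ?thesis using N_def by blast
    next
      case False
      obtain b where b: "b \<in> X" using \<open>X \<noteq> {}\<close> by blast
      have "{y\<in>X. (b, y) \<in> E} \<subseteq> X - {b}" using irrE by auto
      then have "card {y\<in>X. (b, y) \<in> E} \<le> card (X - {b})" using \<open>finite X\<close> by (simp add: card_mono)
      moreover have "0 < card X" using b \<open>finite X\<close> by (auto simp: card_gt_0_iff)
      ultimately have "card S' < card X" using deg[OF b] card b \<open>finite X\<close> by simp
      then have "\<not> X \<subseteq> g ` S'" using S(3) cg by (metis card_mono finite_imageI leD)
      then show ?thesis using False by blast
    qed
    then obtain a where a: "a \<in> X" "a \<notin> g ` S'" "\<And>y. y \<in> S' \<Longrightarrow> (y, x) \<in> R \<Longrightarrow> (g y, a) \<in> E"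
      by blast
    let ?g = "g(x := a)"
    have im: "?g ` S' = g ` S'" using S(2) by (auto simp: image_def)
    have "inj_on ?g S'" using g(1) S(2) by (simp add: inj_on_fun_updI a(2))
    then have "inj_on ?g S" using S a(2) im by simp
    moreover have "?g ` S \<subseteq> X" using S(1) im a g(2) by auto
    moreover have "(?g y, ?g z) \<in> E" if "y \<in> S" "z \<in> S" "(y, z) \<in> R" for y z
      using that S(1,2) g(3) a(3) irrR symD[OF symR] symD[OF symE] by auto
    ultimately show ?thesis by blast
  qed auto
qed

text \<open>Remove a vertex with fewer than \<open>k\<close> neighbours and colour the rest
  inductively; the neighbours of the removed vertex cannot use up all \<open>k\<close>
  colours.\<close>

lemma greedy_colouring:
  assumes "finite X"
    and degen: "\<And>Y. Y \<subseteq> X \<Longrightarrow> Y \<noteq> {} \<Longrightarrow> \<exists>x\<in>Y. card {y\<in>Y. (x, y) \<in> E} < k"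
    and symE: "sym E" and irrE: "\<And>x. (x, x) \<notin> E"
  shows "\<exists>c :: 'a \<Rightarrow> nat. c ` X \<subseteq> {..<k} \<and> (\<forall>x\<in>X. \<forall>y\<in>X. (x, y) \<in> E \<longrightarrow> c x \<noteq> c y)"
  using \<open>finite X\<close> degen
proof (induction X rule: finite_psubset_induct)
  case (psubset X)
  show ?case
  proof (cases "X = {}")
    case False
    then obtain x where x: "x \<in> X" "card {y\<in>X. (x, y) \<in> E} < k" using psubset.prems[of X] by auto
    have "X - {x} \<subset> X" using x by auto
    then have "\<exists>c :: 'a \<Rightarrow> nat. c ` (X - {x}) \<subseteq> {..<k} \<and>
        (\<forall>y\<in>X - {x}. \<forall>z\<in>X - {x}. (y, z) \<in> E \<longrightarrow> c y \<noteq> c z)"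
      using psubset.prems by (intro psubset.IH) auto
    then obtain c :: "'a \<Rightarrow> nat" where c: "c ` (X - {x}) \<subseteq> {..<k}"
      "\<And>y z. y \<in> X - {x} \<Longrightarrow> z \<in> X - {x} \<Longrightarrow> (y, z) \<in> E \<Longrightarrow> c y \<noteq> c z"
      by blast
    have "card (c ` {y\<in>X. (x, y) \<in> E}) < card {..<k}"
      using x(2) card_image_le[of "{y\<in>X. (x, y) \<in> E}" c] psubset.hyps by simp
    then have "\<not> {..<k} \<subseteq> c ` {y\<in>X. (x, y) \<in> E}"
      using psubset.hyps card_mono[of "c ` {y\<in>X. (x, y) \<in> E}" "{..<k}"] by auto
    then obtain a where a: "a < k" "a \<notin> c ` {y\<in>X. (x, y) \<in> E}" by auto
    show ?thesis
    proof (intro exI[of _ "c(x := a)"] conjI ballI impI)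
      show "(c(x := a)) ` X \<subseteq> {..<k}" using c(1) a(1) by auto
      fix y z assume "y \<in> X" "z \<in> X" "(y, z) \<in> E"
      then show "(c(x := a)) y \<noteq> (c(x := a)) z"
        using c(2) a(2) symE irrE by (auto dest: symD)
    qed
  qed auto
qed

section \<open>Graph homomorphisms and copies of \<open>H\<close>\<close>

text \<open>A digraph isomorphism also carries an arc map and new head and tail functions. As arcs
  are pairs, \<open>g\<close> determines all of these, and the image of \<open>H\<close> is the
  required subgraph.\<close>

lemma not_free_ofI:
  assumes H: "pair_graph H" and G: "pair_graph G"
    and inj: "inj_on g (pverts H)" and verts: "g ` pverts H \<subseteq> pverts G"
    and arcs: "\<And>x y. (x, y) \<in> parcs H \<Longrightarrow> (g x, g y) \<in> parcs G"
  shows "\<not> free_of H G"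
proof -
  interpret H: pair_graph H by fact
  interpret G: pair_graph G by fact
  define h where "h = \<lparr>iso_verts = g, iso_arcs = map_prod g g, iso_head = snd, iso_tail = fst\<rparr>"
  have "inj_on (map_prod g g) (parcs H)"
    using map_prod_inj_on[OF inj inj] by (rule inj_on_subset) (use H.in_arcsD1 H.in_arcsD2 in auto)
  then have iso: "pre_digraph.digraph_isomorphism (with_proj H) h"
    unfolding pre_digraph.digraph_isomorphism_def
    using inj H.wf_digraph by (auto simp: h_def with_proj_def)
  have "wf_digraph (app_iso h (with_proj H))"
    using H.wf_digraphI_app_iso[OF iso] .
  then have "subgraph (app_iso h (with_proj H)) (with_proj G)"
    using verts arcs G.wf_digraph
    by (auto simp: subgraph_def compatible_def h_def)
  then show ?thesis using iso unfolding free_of_def digraph_iso_def by blast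
qed

lemma not_free_ofE:
  assumes "\<not> free_of H G"
  obtains g where "inj_on g (pverts H)" "g ` pverts H \<subseteq> pverts G"
    "\<And>x y. (x, y) \<in> parcs H \<Longrightarrow> (g x, g y) \<in> parcs G"
proof -
  obtain h where sub: "subgraph (app_iso h (with_proj H)) (with_proj G)"
    and iso: "pre_digraph.digraph_isomorphism (with_proj H) h"
    using assms unfolding free_of_def digraph_iso_def by blast
  show thesis
  proof (rule that[of "iso_verts h"])
    show "inj_on (iso_verts h) (pverts H)" "iso_verts h ` pverts H \<subseteq> pverts G"
      using sub iso by (auto simp: subgraph_def pre_digraph.digraph_isomorphism_def)
    fix x y assume xy: "(x, y) \<in> parcs H"
    \<comment> \<open>A subgraph shares head and tail functions with the host graph, so those of the
      image are the projections. This forces the arc map to act on pairs through the vertex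
      map.\<close>
    have ht: "iso_head h = snd" "iso_tail h = fst"
      using sub by (auto simp: subgraph_def compatible_def)
    have "iso_arcs h (x, y) = (iso_verts h x, iso_verts h y)"
      using iso xy ht unfolding pre_digraph.digraph_isomorphism_def
      by (auto simp: prod_eq_iff)
    then show "(iso_verts h x, iso_verts h y) \<in> parcs G"
      using sub xy by (force simp: subgraph_def)
  qed
qed

text \<open>Confines a copy of a connected graph to a single clique, with \<open>b\<close> the
  clique index. Connectedness means reachability in the symmetric closure, so the induction may
  follow arcs in either direction.\<close>

lemma connected_constant:
  assumes "Digraph_Component.connected (with_proj H)"
    and const: "\<And>x y. (x, y) \<in> parcs H \<Longrightarrow> b x = b y"
    and "x \<in> pverts H" "y \<in> pverts H"
  shows "b x = b y"
proof -
  have "(x, y) \<in> rtrancl_on (pverts H) (parcs (mk_symmetric (with_proj H)))"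
    using assms(1,3,4)
    by (auto simp: connected_def strongly_connected_def reachable_def mk_symmetric_def)
  then show ?thesis
    by (induction rule: rtrancl_on_induct) (auto simp: mk_symmetric_def dest: const)
qed

text \<open>Walks are lists of arcs. Zipping a vertex list with its own shift yields the arcs
  between consecutive vertices.\<close>

lemma walk_of_vertex_list:
  assumes "tail G = fst" "head G = snd" "successively (\<lambda>x y. (x, y) \<in> arcs G) (u # c @ [v])"
  shows "pre_digraph.cas G u (zip (u # c) (c @ [v])) v"
    and "pre_digraph.awalk_verts G u (zip (u # c) (c @ [v])) = u # c @ [v]"
    and "set (zip (u # c) (c @ [v])) \<subseteq> arcs G"
  using assms(3)
  by (induction c arbitrary: u)
    (auto simp: assms(1,2) pre_digraph.cas.simps pre_digraph.awalk_verts.simps)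

text \<open>Supplies the forest hypothesis of \<open>forest_embeds_if_min_degree\<close>: if every
  vertex of \<open>S\<close> had two neighbours in \<open>S\<close>,
  \<open>exists_cycle_list\<close> would produce a cycle in the tree.\<close>

lemma undirected_tree_leaf:
  assumes tree: "undirected_tree (induce_subgraph (with_proj H) T)"
    and H: "pair_graph H" and S: "S \<subseteq> T" "S \<noteq> {}"
  shows "\<exists>x\<in>S. \<forall>y\<in>S. \<forall>z\<in>S. (y, x) \<in> parcs H \<longrightarrow> (z, x) \<in> parcs H \<longrightarrow> y = z"
proof (rule ccontr)
  assume contr: "\<not> ?thesis"
  interpret H: pair_graph H by fact
  let ?G = "induce_subgraph (with_proj H) T"
  interpret G: graph ?G using tree by (simp add: undirected_tree_def)
  have "finite S" using G.finite_verts S(1) by (simp add: finite_subset)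
  moreover have "(x, x) \<notin> parcs H" for x using H.no_loops' by blast
  moreover have "\<exists>y\<in>S. \<exists>z\<in>S. y \<noteq> z \<and> (y, x) \<in> parcs H \<and> (z, x) \<in> parcs H" if "x \<in> S" for x
    using contr that by blast
  ultimately obtain c where c: "distinct c" "3 \<le> length c" "set c \<subseteq> S"
    "(last c, hd c) \<in> parcs H" "successively (\<lambda>x y. (x, y) \<in> parcs H) c"
    using \<open>S \<noteq> {}\<close> by (elim exists_cycle_list)
  then obtain u r where ur: "c = u # r" by (cases c) auto
  have "successively (\<lambda>x y. (x, y) \<in> parcs H) (u # r @ [u])"
    using c(4,5) ur successively_append_iff[of _ "u # r" "[u]"] by simp
  then have "successively (\<lambda>x y. (x, y) \<in> arcs ?G) (u # r @ [u])"
    by (rule successively_mono) (use c(3) S(1) ur in auto)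
  note walk = walk_of_vertex_list[OF _ _ this]
  let ?p = "zip (u # r) (r @ [u])"
  \<comment> \<open>The vertices of the closed walk after the first are \<open>r @ [u]\<close>, a
    rotation of \<open>c\<close>, and hence distinct.\<close>
  have "pre_digraph.cycle ?G ?p"
    unfolding pre_digraph.cycle_def pre_digraph.awalk_def
    using walk c(1,3) S(1) ur by (intro exI[of _ u]) auto
  moreover have "3 \<le> length ?p" using c(2) ur by simp
  ultimately show False using tree unfolding undirected_tree_def by blast
qed

section \<open>The lower bound\<close>

lemma orthonormal_representation_scalar_prod:
  assumes "orthonormal_representation G d f"
  shows "u \<in> pverts G \<Longrightarrow> f u \<in> carrier_vec d"
    and "u \<in> pverts G \<Longrightarrow> f u \<bullet> f u = 1"
    and "u \<in> pverts G \<Longrightarrow> v \<in> pverts G \<Longrightarrow> u \<noteq> v \<Longrightarrow> (u, v) \<notin> parcs G \<Longrightarrow> f u \<bullet> f v = 0"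
  using assms by (auto simp: orthonormal_representation_def)

text \<open>A colour class is independent, so \<open>f\<close> maps it to an orthonormal family, and
  by Bessel's inequality it contributes at most \<open>f w \<bullet> f w = 1\<close>.\<close>

lemma coloured_projection_sum:
  assumes f: "orthonormal_representation G d f"
    and X: "finite X" "X \<subseteq> pverts G" and w: "w \<in> pverts G"
    and c: "c ` X \<subseteq> {..<k::nat}" "\<And>x y. x \<in> X \<Longrightarrow> y \<in> X \<Longrightarrow> (x, y) \<in> parcs G \<Longrightarrow> c x \<noteq> c y"
  shows "(\<Sum>x\<in>X. (f x \<bullet> f w)\<^sup>2) \<le> k"
proof -
  have "(\<Sum>x\<in>X. (f x \<bullet> f w)\<^sup>2) = (\<Sum>i<k. \<Sum>x | x \<in> X \<and> c x = i. (f x \<bullet> f w)\<^sup>2)"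
    using X(1) c(1) by (simp add: sum.group)
  also have "\<dots> \<le> (\<Sum>i<k. f w \<bullet> f w)"
  proof (intro sum_mono Bessel_vec)
    fix i x y assume "x \<in> {x. x \<in> X \<and> c x = i}" "y \<in> {x. x \<in> X \<and> c x = i}"
    then show "f x \<bullet> f y = (if x = y then 1 else 0)"
      using orthonormal_representation_scalar_prod(2,3)[OF f] X(2) c(2)[of x y] by auto
  qed (use X w orthonormal_representation_scalar_prod(1)[OF f] in auto)
  also have "\<dots> = k" using orthonormal_representation_scalar_prod(2)[OF f w] by simp
  finally show ?thesis .
qed

text \<open>Row \<open>w\<close> of the Gram matrix vanishes outside \<open>w\<close> and its
  neighbours; the diagonal entry gives 1 and the neighbours at most \<open>k\<close>. Summing over
  all rows and comparing with \<open>card_squared_le_Gram\<close> leaves one factor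
  \<open>card (pverts G)\<close> to cancel.\<close>

lemma card_le_if_neighbourhoods_colourable:
  assumes G: "pair_graph G" and f: "orthonormal_representation G d f"
    and col: "\<And>w. w \<in> pverts G \<Longrightarrow> \<exists>c :: _ \<Rightarrow> nat. c ` {x. (w, x) \<in> parcs G} \<subseteq> {..<k} \<and>
      (\<forall>x\<in>{x. (w, x) \<in> parcs G}. \<forall>y\<in>{x. (w, x) \<in> parcs G}. (x, y) \<in> parcs G \<longrightarrow> c x \<noteq> c y)"
  shows "card (pverts G) \<le> Suc k * d"
proof -
  interpret G: pair_graph G by fact
  let ?V = "pverts G"
  have fin: "finite ?V" by (rule G.pair_finite_verts)
  have "(\<Sum>x\<in>?V. (f x \<bullet> f w)\<^sup>2) \<le> real (Suc k)" if w: "w \<in> ?V" for w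
  proof -
    define N where "N = {x. (w, x) \<in> parcs G}"
    have N: "N \<subseteq> ?V" "w \<notin> N" using G.in_arcsD2 G.no_loops' by (auto simp: N_def)
    then have "finite N" using fin finite_subset by blast
    obtain c :: "_ \<Rightarrow> nat" where c: "c ` N \<subseteq> {..<k}"
      "\<And>x y. x \<in> N \<Longrightarrow> y \<in> N \<Longrightarrow> (x, y) \<in> parcs G \<Longrightarrow> c x \<noteq> c y"
      using col[OF w] unfolding N_def by blast
    have "(\<Sum>x\<in>?V. (f x \<bullet> f w)\<^sup>2) = (\<Sum>x\<in>insert w N. (f x \<bullet> f w)\<^sup>2)"
    proof (rule sum.mono_neutral_right[OF fin])
      show "\<forall>x\<in>?V - insert w N. (f x \<bullet> f w)\<^sup>2 = 0"
        using orthonormal_representation_scalar_prod(3)[OF f _ w] G.arcs_symmetric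
        by (auto simp: N_def)
    qed (use N w in auto)
    also have "\<dots> = 1 + (\<Sum>x\<in>N. (f x \<bullet> f w)\<^sup>2)"
      using N \<open>finite N\<close> orthonormal_representation_scalar_prod(2)[OF f w] by simp
    also have "\<dots> \<le> Suc k"
      using coloured_projection_sum[OF f \<open>finite N\<close> N(1) w c] by simp
    finally show ?thesis .
  qed
  then have "(\<Sum>w\<in>?V. \<Sum>x\<in>?V. (f x \<bullet> f w)\<^sup>2) \<le> (\<Sum>w\<in>?V. real (Suc k))"
    by (rule sum_mono)
  then have "(\<Sum>x\<in>?V. \<Sum>w\<in>?V. (f x \<bullet> f w)\<^sup>2) \<le> card ?V * real (Suc k)"
    by (subst sum.swap) simp
  then have "d * (\<Sum>x\<in>?V. \<Sum>w\<in>?V. (f x \<bullet> f w)\<^sup>2) \<le> d * (card ?V * real (Suc k))"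
    by (rule mult_left_mono) simp
  moreover have "(real (card ?V))\<^sup>2 \<le> d * (\<Sum>x\<in>?V. \<Sum>w\<in>?V. (f x \<bullet> f w)\<^sup>2)"
    using orthonormal_representation_scalar_prod(1,2)[OF f] by (rule card_squared_le_Gram)
  ultimately have "real (card ?V * card ?V) \<le> real (card ?V * (Suc k * d))"
    unfolding power2_eq_square[of "real _"] by (simp only: of_nat_mult mult_ac)
  then have "card ?V * card ?V \<le> card ?V * (Suc k * d)" by (simp only: of_nat_le_iff)
  \<comment> \<open>Cancelling requires a nonzero factor; for the empty graph the bound is
    trivial.\<close>
  then show ?thesis by (cases "card ?V = 0") auto
qed

text \<open>A copy of the tree inside a neighbourhood, together with the centre \<open>w\<close>,
  would contain \<open>H\<close>. Hence every neighbourhood is \<open>(t - 1)\<close>-degenerate in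
  the sense of \<open>greedy_colouring\<close>.\<close>

lemma card_le_if_free:
  assumes "1 \<le> t" and H: "pair_graph H" and "pverts H = T \<union> {v}" "v \<notin> T"
    and tree: "undirected_tree (induce_subgraph (with_proj H) T)" and "card T = t"
    and G: "pair_graph G" and free: "free_of H G" and f: "orthonormal_representation G d f"
  shows "card (pverts G) \<le> t * d"
proof -
  interpret H: pair_graph H by fact
  interpret G: pair_graph G by fact
  have "finite T" using H.pair_finite_verts \<open>pverts H = T \<union> {v}\<close> by simp
  have symE: "sym (parcs G)" using G.arcs_symmetric by (auto intro: symI)
  have irrE: "(x, x) \<notin> parcs G" for x using G.no_loops' by blast
  have "\<exists>c :: _ \<Rightarrow> nat. c ` {x. (w, x) \<in> parcs G} \<subseteq> {..<t - 1} \<and>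
      (\<forall>x\<in>{x. (w, x) \<in> parcs G}. \<forall>y\<in>{x. (w, x) \<in> parcs G}. (x, y) \<in> parcs G \<longrightarrow> c x \<noteq> c y)"
    if w: "w \<in> pverts G" for w
  proof (rule greedy_colouring[OF _ _ symE irrE])
    show "finite {x. (w, x) \<in> parcs G}"
      by (rule finite_subset[OF _ G.pair_finite_verts]) (auto dest: G.in_arcsD2)
    fix Y assume Y: "Y \<subseteq> {x. (w, x) \<in> parcs G}" "Y \<noteq> {}"
    \<comment> \<open>For \<open>t = 1\<close> no such \<open>x\<close> can exist, so the claim then
      amounts to \<open>w\<close> having no neighbours at all.\<close>
    show "\<exists>x\<in>Y. card {y\<in>Y. (x, y) \<in> parcs G} < t - 1"
    proof (rule ccontr)
      assume "\<not> ?thesis"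
      then have deg: "t \<le> Suc (card {y\<in>Y. (x, y) \<in> parcs G})" if "x \<in> Y" for x
        using that by force
      have "finite Y"
        by (rule finite_subset[OF _ G.pair_finite_verts]) (use Y in \<open>auto dest: G.in_arcsD2\<close>)
      have "\<exists>g. inj_on g T \<and> g ` T \<subseteq> Y \<and>
          (\<forall>x\<in>T. \<forall>y\<in>T. (x, y) \<in> parcs H \<longrightarrow> (g x, g y) \<in> parcs G)"
      proof (rule forest_embeds_if_min_degree[OF \<open>finite T\<close> _ _ _ _ symE irrE \<open>finite Y\<close> Y(2) deg])
        show "card T \<le> t" using \<open>card T = t\<close> by simp
        show "sym (parcs H)" using H.arcs_symmetric by (auto intro: symI)
        show "(x, x) \<notin> parcs H" for x using H.no_loops' by blast
      qed (rule undirected_tree_leaf[OF tree H])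
      then obtain g where g: "inj_on g T" "g ` T \<subseteq> Y"
        "\<And>x y. x \<in> T \<Longrightarrow> y \<in> T \<Longrightarrow> (x, y) \<in> parcs H \<Longrightarrow> (g x, g y) \<in> parcs G"
        by blast
      have Tw: "(w, g x) \<in> parcs G" "(g x, w) \<in> parcs G" if "x \<in> T" for x
        using g(2) Y(1) that G.arcs_symmetric by auto
      \<comment> \<open>Since \<open>w\<close> is adjacent to all of \<open>Y\<close>, the arcs of
        \<open>H\<close> at \<open>v\<close> are preserved whichever vertices of \<open>T\<close>
        they meet.\<close>
      let ?g = "g(v := w)"
      have "w \<notin> g ` T" using Tw irrE by auto
      then have "inj_on ?g (pverts H)"
        using g(1) \<open>v \<notin> T\<close> \<open>pverts H = T \<union> {v}\<close> by (auto simp: inj_on_def)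
      moreover have "?g ` pverts H \<subseteq> pverts G"
        using w Tw G.in_arcsD2 \<open>pverts H = T \<union> {v}\<close> by auto
      moreover have "(?g x, ?g y) \<in> parcs G" if "(x, y) \<in> parcs H" for x y
        using that H.in_arcsD1[OF that] H.in_arcsD2[OF that] H.no_loops'[OF that]
          g(3) Tw \<open>pverts H = T \<union> {v}\<close> by auto
      ultimately have "\<not> free_of H G" by (rule not_free_ofI[OF H G])
      then show False using free by simp
    qed
  qed
  then have "card (pverts G) \<le> Suc (t - 1) * d"
    by (rule card_le_if_neighbourhoods_colourable[OF G f])
  then show ?thesis using \<open>1 \<le> t\<close> by simp
qed

text \<open>Ensures that the infimum in \<open>msr\<close> is attained.\<close>

lemma exists_orthonormal_representation:
  assumes "finite (pverts G)"
  shows "\<exists>d f. orthonormal_representation G d f"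
proof -
  obtain h :: "_ \<Rightarrow> nat" where h: "bij_betw h (pverts G) {0..<card (pverts G)}"
    using ex_bij_betw_finite_nat[OF assms] by blast
  then have lt: "h u < card (pverts G)" if "u \<in> pverts G" for u
    using that bij_betwE by fastforce
  have "orthonormal_representation G (card (pverts G)) (\<lambda>u. unit_vec (card (pverts G)) (h u))"
    unfolding orthonormal_representation_def
    using lt h by (auto simp: scalar_prod_left_unit bij_betw_def inj_on_eq_iff)
  then show ?thesis by blast
qed

section \<open>Disjoint cliques\<close>

text \<open>For \<open>t > 0\<close> the cliques are the blocks of \<open>t\<close> consecutive
  numbers, the last one possibly shorter, and \<open>x div t\<close> is the index of the block of
  \<open>x\<close>.\<close>

definition disjoint_cliques :: "nat \<Rightarrow> nat \<Rightarrow> nat pair_pre_digraph" where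
  "disjoint_cliques n t =
     \<lparr>pverts = {..<n}, parcs = {(x, y). x < n \<and> y < n \<and> x \<noteq> y \<and> x div t = y div t}\<rparr>"

lemma pair_graph_disjoint_cliques: "pair_graph (disjoint_cliques n t)"
proof
  show "finite (parcs (disjoint_cliques n t))"
    by (rule finite_subset[of _ "{..<n} \<times> {..<n}"]) (auto simp: disjoint_cliques_def)
  show "symmetric (with_proj (disjoint_cliques n t))"
    by (auto simp: symmetric_def disjoint_cliques_def intro: symI)
qed (auto simp: disjoint_cliques_def)

text \<open>A copy of a connected graph stays within one block, and a block has at most
  \<open>t\<close> vertices.\<close>

lemma free_of_disjoint_cliques:
  assumes "0 < t" and con: "Digraph_Component.connected (with_proj H)" and "t < card (pverts H)"
  shows "free_of H (disjoint_cliques n t)"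
proof (rule ccontr)
  assume "\<not> ?thesis"
  then obtain g where inj: "inj_on g (pverts H)"
    and arcs: "\<And>x y. (x, y) \<in> parcs H \<Longrightarrow> (g x, g y) \<in> parcs (disjoint_cliques n t)"
    by (rule not_free_ofE) blast
  obtain z where z: "z \<in> pverts H" using \<open>t < card (pverts H)\<close> by fastforce
  have block: "g x div t = g z div t" if "x \<in> pverts H" for x
    by (rule connected_constant[OF con _ that z]) (use arcs in \<open>auto simp: disjoint_cliques_def\<close>)
  have "y \<in> {y div t * t..<y div t * t + t}" for y
    using \<open>0 < t\<close> dividend_less_div_times[of t y] by simp
  then have "g ` pverts H \<subseteq> {g z div t * t..<g z div t * t + t}"
    using block by (metis image_subsetI)
  then have "card (g ` pverts H) \<le> card {g z div t * t..<g z div t * t + t}"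
    by (rule card_mono[rotated]) simp
  then show False using card_image[OF inj] \<open>t < card (pverts H)\<close> by simp
qed

text \<open>Each clique shares one coordinate vector, and distinct non-adjacent vertices lie in
  different cliques. The hypothesis makes every block index smaller than \<open>m\<close>.\<close>

lemma orthonormal_representation_disjoint_cliques:
  assumes "n \<le> t * m"
  shows "orthonormal_representation (disjoint_cliques n t) m (\<lambda>u. unit_vec m (u div t))"
proof -
  have "u div t < m" if "u < n" for u
    using that assms by (metis less_le_trans less_mult_imp_div_less mult.commute)
  then show ?thesis
    by (auto simp: orthonormal_representation_def disjoint_cliques_def scalar_prod_left_unit)
qed

section \<open>Matching the two bounds\<close>

theorem theorem1p10:
  fixes H :: "'h pair_pre_digraph" and T :: "'h set" and v :: 'h and t n :: nat
  assumes "t \<ge> 1"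
    and "pair_graph H"
    and "Digraph_Component.connected (with_proj H)"
    and "pverts H = T \<union> {v}" and "v \<notin> T"
    and "undirected_tree (induce_subgraph (with_proj H) T)" and "card T = t"
    and "n \<ge> 1"
  shows "int (rho n H) = \<lceil>real n / real t\<rceil>"
proof -
  define A where "A = {msr G | G :: nat pair_pre_digraph.
     pair_graph G \<and> card (pverts G) = n \<and> free_of H G}"
  define m where "m = nat \<lceil>real n / real t\<rceil>"
  have "0 \<le> \<lceil>real n / real t\<rceil>" using ceiling_mono[of 0 "real n / real t"] by simp
  then have m: "int m = \<lceil>real n / real t\<rceil>" by (simp add: m_def)
  \<comment> \<open>This equivalence reduces both bounds to the naturals: \<open>d = m\<close>
    yields a dimension large enough for the cliques, and \<open>d = msr G\<close> gives the lower
    bound.\<close>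
  have ceil: "m \<le> d \<longleftrightarrow> n \<le> t * d" for d
  proof -
    have "m \<le> d \<longleftrightarrow> \<lceil>real n / real t\<rceil> \<le> int d" using m by linarith
    also have "\<dots> \<longleftrightarrow> real n \<le> real (t * d)"
      using \<open>t \<ge> 1\<close> by (simp add: ceiling_le_iff divide_le_eq mult.commute)
    finally show ?thesis by (simp only: of_nat_le_iff)
  qed
  let ?C = "disjoint_cliques n t"
  \<comment> \<open>An infinite set has cardinality 0, which \<open>t \<ge> 1\<close>
    excludes.\<close>
  have "finite T" using \<open>card T = t\<close> \<open>t \<ge> 1\<close> card.infinite by fastforce
  then have "card (pverts H) = Suc t" using assms(4,5,7) by simp
  then have "free_of H ?C" using assms(1,3) by (intro free_of_disjoint_cliques) auto
  moreover have "card (pverts ?C) = n" by (simp add: disjoint_cliques_def)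
  ultimately have C: "msr ?C \<in> A" using pair_graph_disjoint_cliques by (auto simp: A_def)
  have "n \<le> t * m" using ceil by blast
  then have "msr ?C \<le> m"
    unfolding msr_def using orthonormal_representation_disjoint_cliques
    by (intro cInf_lower) auto
  then have le: "Inf A \<le> m" using C cInf_lower[OF C] by auto
  \<comment> \<open>The clique graph makes \<open>A\<close> nonempty, so the minimum is attained by
    an actual graph, to which the lower bound applies.\<close>
  have "Inf A \<in> A" using C by (intro Inf_nat_def1) auto
  then obtain G :: "nat pair_pre_digraph" where G: "Inf A = msr G"
    "pair_graph G" "card (pverts G) = n" "free_of H G"
    by (auto simp: A_def)
  interpret G: pair_graph G by fact
  have "msr G \<in> {d. \<exists>f. orthonormal_representation G d f}"
    unfolding msr_def using exists_orthonormal_representation[OF G.pair_finite_verts]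
    by (intro Inf_nat_def1) auto
  then obtain f where "orthonormal_representation G (msr G) f" by blast
  then have "n \<le> t * msr G"
    using card_le_if_free[OF assms(1,2,4,5,6,7) G(2,4)] G(3) by blast
  then have "m \<le> Inf A" using ceil G(1) by simp
  then show ?thesis using le m by (simp add: rho_def A_def[symmetric])
qed

end
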